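(* Let $(\mathcal{C},F)$ be a generalized network code. If $F$ is error-linear, then $D_0(x_1,x_2)=D_1(x_1,x_2)$ for all $x_1,x_2\in\mathcal{C}$.
   Context: A generalized network channel consists of a set $\mathcal{C}$ of codewords, a set $\mathcal{E}$ of errors with a distinguished element $0$ (the zero error), an output set $\mathcal{Y}$, a weight $w:\mathcal{E}\to\mathbb{Z}_{\ge 0}$ with $w(z)=0$ if and only if $z=0$, and a transfer function $F:\mathcal{C}\times\mathcal{E}\to\mathcal{Y}$ such that $F(x,0)\ne F(x',0)$ whenever $x\neq x'$ in $\mathcal{C}$. The sets are otherwise arbitrary. The pair $(\mathcal{C},F)$ is called a generalized network code; $|\mathcal{C}|\ge 2$ is assumed. The channel $F$ is called error-linear if: (i) $\mathcal{E}$ is a (not necessarily abelian) group with operation $\circ$ and identity $0$; (ii) $\mathcal{Y}$ is an abelian group with operation $\oplus$ and identity $0$; (iii) $F(x,z)=f(x)\oplus h(z)$ for some function $f:\mathcal{C}\to\mathcal{Y}$ and some group homomorphism $h:\mathcal{E}\to\mathcal{Y}$; (iv) $w(z\circ z')\le w(z)+w(z')$ for all $z,z'\in\mathcal{E}$; (v) $w(z^{-1})=w(z)$ for all $z\in\mathcal{E}$; (vi) for every $z\in\mathcal{E}$ and integers $c_1,c_2\ge 0$ with $c_1+c_2=w(z)$ there exist $z_1,z_2\in\mathcal{E}$ with $w(z_1)=c_1$, $w(z_2)=c_2$ and $z_1\circ z_2=z$. For $x\in\mathcal{C}$ and an integer $c\ge 0$, the decoding ball is $\Phi(x,c)=\{F(x,z):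 z\in\mathcal{E},\ w(z)\le c\}$. For $x_1,x_2\in\mathcal{C}$ (all $c$'s are nonnegative integers, and a minimum over the empty set is $+\infty$): $D_0(x_1,x_2)=\min\{c_1+c_2 : |c_1-c_2|\le 1,\ \Phi(x_1,c_1)\cap\Phi(x_2,c_2)\ne\emptyset\}$; $D_1(x_1,x_2)=\min\{c : \Phi(x_1,0)\cap\Phi(x_2,c)\neq\emptyset\}$. *)

theory Defs
  imports "HOL-Algebra.Group" "HOL-Library.Extended_Nat"
begin

locale generalized_network_channel =
  fixes C :: "'c set" and E :: "'e set" and e0 :: 'e and Y :: "'y set"
    and w :: "'e \<Rightarrow> nat" and F :: "'c \<Rightarrow> 'e \<Rightarrow> 'y"
  assumes zero_error: "e0 \<in> E"
    and weight_zero_iff: "z \<in> E \<Longrightarrow> w z = 0 \<longleftrightarrow> z = e0"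
    and transfer_closed: "x \<in> C \<Longrightarrow> z \<in> E \<Longrightarrow> F x z \<in> Y"
    and transfer_inj: "x \<in> C \<Longrightarrow> x' \<in> C \<Longrightarrow> x \<noteq> x' \<Longrightarrow> F x e0 \<noteq> F x' e0"

text \<open>The size condition is stated with two witnesses because \<open>card\<close> is 0 on infinite sets
  and infinite codes are allowed.\<close>

locale generalized_network_code = generalized_network_channel +
  assumes two_codewords: "\<exists>x\<in>C. \<exists>x'\<in>C. x \<noteq> x'"

text \<open>Both groups are HOL-Algebra records in multiplicative notation, so \<open>\<one>\<^bsub>H\<^esub>\<close>
  is the zero and \<open>\<otimes>\<^bsub>H\<^esub>\<close> the addition of the output group. The existential quantifiers
  make error-linearity a property of the bare channel; only the underlying set and the
  identity of the error group are prescribed by it.\<close>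

definition error_linear ::
  "'c set \<Rightarrow> 'e set \<Rightarrow> 'e \<Rightarrow> 'y set \<Rightarrow> ('e \<Rightarrow> nat) \<Rightarrow> ('c \<Rightarrow> 'e \<Rightarrow> 'y) \<Rightarrow> bool" where
  "error_linear C E e0 Y w F \<longleftrightarrow>
    (\<exists>(G :: 'e monoid) (H :: 'y monoid) f h.
       group G \<and> carrier G = E \<and> \<one>\<^bsub>G\<^esub> = e0 \<and>
       comm_group H \<and> carrier H = Y \<and>
       f \<in> C \<rightarrow> Y \<and> h \<in> hom G H \<and>
       (\<forall>x\<in>C. \<forall>z\<in>E. F x z = f x \<otimes>\<^bsub>H\<^esub> h z) \<and>
       (\<forall>z\<in>E. \<forall>z'\<in>E. w (z \<otimes>\<^bsub>G\<^esub> z') \<le> w z + w z') \<and>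
       (\<forall>z\<in>E. w (inv\<^bsub>G\<^esub> z) = w z) \<and>
       (\<forall>z\<in>E. \<forall>c1 c2. c1 + c2 = w z \<longrightarrow>
          (\<exists>z1\<in>E. \<exists>z2\<in>E. w z1 = c1 \<and> w z2 = c2 \<and> z1 \<otimes>\<^bsub>G\<^esub> z2 = z)))"

definition decoding_ball ::
  "'e set \<Rightarrow> ('e \<Rightarrow> nat) \<Rightarrow> ('c \<Rightarrow> 'e \<Rightarrow> 'y) \<Rightarrow> 'c \<Rightarrow> nat \<Rightarrow> 'y set" where
  "decoding_ball E w F x c = {F x z | z. z \<in> E \<and> w z \<le> c}"

text \<open>In \<^typ>\<open>enat\<close> the infimum of the empty set is \<open>\<infinity>\<close>, and that of a nonempty set
  is its minimum.\<close>

definition D0 :: "'e set \<Rightarrow> ('e \<Rightarrow> nat) \<Rightarrow> ('c \<Rightarrow> 'e \<Rightarrow> 'y) \<Rightarrow> 'c \<Rightarrow> 'c \<Rightarrow> enat" where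
  "D0 E w F x1 x2 =
    Inf {enat (c1 + c2) | c1 c2. \<bar>int c1 - int c2\<bar> \<le> 1 \<and>
           decoding_ball E w F x1 c1 \<inter> decoding_ball E w F x2 c2 \<noteq> {}}"

definition D1 :: "'e set \<Rightarrow> ('e \<Rightarrow> nat) \<Rightarrow> ('c \<Rightarrow> 'e \<Rightarrow> 'y) \<Rightarrow> 'c \<Rightarrow> 'c \<Rightarrow> enat" where
  "D1 E w F x1 x2 =
    Inf {enat c | c. decoding_ball E w F x1 0 \<inter> decoding_ball E w F x2 c \<noteq> {}}"

end

theory Submission
  imports Defs
begin

text \<open>In an error-linear channel an error can be moved from one codeword to the other:
  \<open>f x\<^sub>1 \<oplus> h z\<^sub>1 = f x\<^sub>2 \<oplus> h z\<^sub>2\<close> says that \<open>f x\<^sub>1 = f x\<^sub>2 \<oplus> h (z\<^sub>2 \<circ> z\<^sub>1\<inverse>)\<close>, and conversely an error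
  splits along any partition of its weight. Whether two decoding balls meet therefore depends
  only on the sum of their radii, and every sum of radii is attained by a balanced pair.\<close>

lemma balls_meet_iff:
  assumes chan: "generalized_network_channel C E e0 Y w F"
    and lin: "error_linear C E e0 Y w F"
    and x1: "x1 \<in> C" and x2: "x2 \<in> C"
  shows "decoding_ball E w F x1 c1 \<inter> decoding_ball E w F x2 c2 \<noteq> {} \<longleftrightarrow>
    decoding_ball E w F x1 0 \<inter> decoding_ball E w F x2 (c1 + c2) \<noteq> {}" (is "?L \<longleftrightarrow> ?R")
proof -
  interpret generalized_network_channel C E e0 Y w F by (rule chan)
  obtain G :: "'b monoid" and H :: "'c monoid" and f h where
    G: "group G" and E: "carrier G = E" and e0: "\<one>\<^bsub>G\<^esub> = e0"
    and H: "comm_group H" and Y: "carrier H = Y"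
    and f: "f \<in> C \<rightarrow> Y" and h: "h \<in> hom G H"
    and F: "\<And>x z. x \<in> C \<Longrightarrow> z \<in> E \<Longrightarrow> F x z = f x \<otimes>\<^bsub>H\<^esub> h z"
    and w_mult: "\<And>z z'. z \<in> E \<Longrightarrow> z' \<in> E \<Longrightarrow> w (z \<otimes>\<^bsub>G\<^esub> z') \<le> w z + w z'"
    and w_inv: "\<And>z. z \<in> E \<Longrightarrow> w (inv\<^bsub>G\<^esub> z) = w z"
    and split: "\<And>z c1 c2. z \<in> E \<Longrightarrow> c1 + c2 = w z \<Longrightarrow>
      \<exists>z1\<in>E. \<exists>z2\<in>E. w z1 = c1 \<and> w z2 = c2 \<and> z1 \<otimes>\<^bsub>G\<^esub> z2 = z"
    using lin unfolding error_linear_def by (elim exE conjE) blast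
  interpret G: group G by (rule G)
  interpret H: comm_group H by (rule H)
  interpret gh: group_hom G H h
    using h by unfold_locales
  have hY: "h z \<in> carrier H" if "z \<in> E" for z
    using that gh.hom_closed E by simp
  have h_mult: "h (z \<otimes>\<^bsub>G\<^esub> z') = h z \<otimes>\<^bsub>H\<^esub> h z'" if "z \<in> E" "z' \<in> E" for z z'
    using that gh.hom_mult E by simp
  have h_inv: "h (inv\<^bsub>G\<^esub> z) = inv\<^bsub>H\<^esub> h z" if "z \<in> E" for z
    using that gh.hom_inv E by simp
  have fY: "f x1 \<in> carrier H" "f x2 \<in> carrier H"
    using f x1 x2 Y by auto
  have F0: "F x1 e0 = f x1"
    using F[OF x1 zero_error] gh.hom_one e0 fY by simp
  \<comment> \<open>Only \<open>e0\<close> has weight 0, so this ball is a single point and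
    \<open>?R\<close> becomes one equation with a single unknown error.\<close>
  have ball0: "decoding_ball E w F x1 0 = {f x1}"
    using zero_error weight_zero_iff F0 by (auto simp: decoding_ball_def intro!: exI[of _ e0])
  have meet0: "?R \<longleftrightarrow> (\<exists>z\<in>E. w z \<le> c1 + c2 \<and> f x1 = f x2 \<otimes>\<^bsub>H\<^esub> h z)"
    unfolding ball0 using F[OF x2] by (auto simp: decoding_ball_def)
  have meet: "?L \<longleftrightarrow> (\<exists>z1\<in>E. \<exists>z2\<in>E. w z1 \<le> c1 \<and> w z2 \<le> c2 \<and>
      f x1 \<otimes>\<^bsub>H\<^esub> h z1 = f x2 \<otimes>\<^bsub>H\<^esub> h z2)"
  proof -
    have "?L \<longleftrightarrow> (\<exists>z1\<in>E. \<exists>z2\<in>E. w z1 \<le> c1 \<and> w z2 \<le> c2 \<and> F x1 z1 = F x2 z2)"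
      unfolding decoding_ball_def by blast
    then show ?thesis
      \<comment> \<open>\<open>F\<close> may be expanded only at errors in \<open>E\<close>; the
        congruence rule supplies that membership under the quantifiers.\<close>
      by (simp add: F x1 x2 cong: bex_cong)
  qed
  show ?thesis
    unfolding meet meet0
  proof (intro iffI; elim bexE conjE)
    fix z1 z2
    assume z: "z1 \<in> E" "z2 \<in> E" and w: "w z1 \<le> c1" "w z2 \<le> c2"
      and eq: "f x1 \<otimes>\<^bsub>H\<^esub> h z1 = f x2 \<otimes>\<^bsub>H\<^esub> h z2"
    \<comment> \<open>The error of \<open>x1\<close> changes sides as its inverse; subadditivity and
      the invariance of \<open>w\<close> under inverses bound the weight of the product.\<close>
    let ?z = "z2 \<otimes>\<^bsub>G\<^esub> inv\<^bsub>G\<^esub> z1"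
    have iz: "inv\<^bsub>G\<^esub> z1 \<in> E" and zE: "?z \<in> E" using z E by auto
    have "w ?z \<le> c1 + c2"
      using w_mult[OF z(2) iz] w_inv[OF z(1)] w by simp
    moreover have "f x1 = f x2 \<otimes>\<^bsub>H\<^esub> h z2 \<otimes>\<^bsub>H\<^esub> inv\<^bsub>H\<^esub> h z1"
      unfolding eq[symmetric] using fY hY[OF z(1)] by (simp add: H.m_assoc)
    then have "f x1 = f x2 \<otimes>\<^bsub>H\<^esub> h ?z"
      using fY hY z iz by (simp add: h_mult h_inv H.m_assoc)
    ultimately show "\<exists>z\<in>E. w z \<le> c1 + c2 \<and> f x1 = f x2 \<otimes>\<^bsub>H\<^esub> h z"
      using zE by blast
  next
    fix z assume z: "z \<in> E" and w: "w z \<le> c1 + c2" and eq: "f x1 = f x2 \<otimes>\<^bsub>H\<^esub> h z"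
    \<comment> \<open>Splitting needs parts that sum to \<open>w z\<close> exactly, which may be
      less than \<open>c1 + c2\<close>. So \<open>x2\<close> takes as much as its radius allows, and
      the remainder fits into \<open>c1\<close>.\<close>
    obtain a b where ab: "a + b = w z" "a \<le> c2" "b \<le> c1"
      using that[of "min (w z) c2" "w z - min (w z) c2"] w by auto
    then obtain z1 z2 where z12: "z1 \<in> E" "z2 \<in> E" and w12: "w z1 = a" "w z2 = b"
      and zeq: "z1 \<otimes>\<^bsub>G\<^esub> z2 = z"
      using split[OF z ab(1)] by blast
    \<comment> \<open>The left factor \<open>z1\<close> stays with \<open>x2\<close>. The right
      factor \<open>z2\<close> goes to \<open>x1\<close>, where its inverse cancels
      \<open>h z2\<close>.\<close>
    have "f x1 \<otimes>\<^bsub>H\<^esub> h (inv\<^bsub>G\<^esub> z2) = f x2 \<otimes>\<^bsub>H\<^esub> h z1"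
      unfolding eq zeq[symmetric] using fY hY z12 by (simp add: h_mult h_inv H.m_assoc)
    moreover have "inv\<^bsub>G\<^esub> z2 \<in> E" using z12 E by auto
    ultimately show "\<exists>z1\<in>E. \<exists>z2\<in>E. w z1 \<le> c1 \<and> w z2 \<le> c2 \<and>
        f x1 \<otimes>\<^bsub>H\<^esub> h z1 = f x2 \<otimes>\<^bsub>H\<^esub> h z2"
      using z12 w12 w_inv ab by (intro bexI[of _ "inv\<^bsub>G\<^esub> z2"] bexI[of _ z1]) simp_all
  qed
qed

text \<open>The two halves of \<open>c\<close>, one rounded down and one up, differ by the parity of
  \<open>c\<close>. They provide the radii that \<open>D0\<close> admits.\<close>

lemma ex_balanced_sum: "\<exists>a b :: nat. c = a + b \<and> \<bar>int a - int b\<bar> \<le> 1"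
  by (intro exI[of _ "c div 2"] exI[of _ "c - c div 2"]) linarith

theorem theorem4p5:
  fixes C :: "'c set" and E :: "'e set" and e0 :: 'e and Y :: "'y set"
    and w :: "'e \<Rightarrow> nat" and F :: "'c \<Rightarrow> 'e \<Rightarrow> 'y"
  assumes "generalized_network_code C E e0 Y w F"
    and "error_linear C E e0 Y w F"
  shows "\<forall>x1\<in>C. \<forall>x2\<in>C. D0 E w F x1 x2 = D1 E w F x1 x2"
proof (intro ballI)
  fix x1 x2 assume x: "x1 \<in> C" "x2 \<in> C"
  have chan: "generalized_network_channel C E e0 Y w F"
    using assms(1) by (simp add: generalized_network_code_def)
  note meet = balls_meet_iff[OF chan assms(2) x]
  \<comment> \<open>The two sets of candidate values coincide, so the infima agree even when both
    sets are empty and the distance is infinite.\<close>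
  have "{enat (c1 + c2) | c1 c2. \<bar>int c1 - int c2\<bar> \<le> 1 \<and>
           decoding_ball E w F x1 c1 \<inter> decoding_ball E w F x2 c2 \<noteq> {}} =
        {enat c | c. decoding_ball E w F x1 0 \<inter> decoding_ball E w F x2 c \<noteq> {}}"
    (is "?A = ?B")
  proof
    show "?A \<subseteq> ?B"
      using meet by blast
    show "?B \<subseteq> ?A"
    proof
      fix n assume "n \<in> ?B"
      then obtain c where "n = enat c"
        and ne: "decoding_ball E w F x1 0 \<inter> decoding_ball E w F x2 c \<noteq> {}"
        by blast
      moreover obtain a b where "c = a + b" "\<bar>int a - int b\<bar> \<le> 1"
        using ex_balanced_sum by blast
      ultimately show "n \<in> ?A"
        using meet[of a b] by blast
    qed
  qed
  then show "D0 E w F x1 x2 = D1 E w F x1 x2"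
    by (simp only: D0_def D1_def)
qed

end
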